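(* (Equivalence of optimal Kernel K-means and optimal SNMF.) Let $\{x_i\}_{i=1}^n$ be a dataset transformed into a Reproducing Kernel Hilbert Space (RKHS) via an optimal neural network $f^*$, resulting in the optimal kernel matrix $A^*=f^*(X)^\top f^*(X)$, which is the unnormalized version of $\bar A^*$. Then the optimal Kernel K-means objective can be reformulated as $$\min\mathcal{L}_{A^*}=\min\Bigl(\sum_i\|f^*(x_i)\|^2-\sum_k\sum_{i,j\in C_k}h_k^\top f^*(x_i)^\top f^*(x_j)h_k\Bigr)=\min\operatorname{Tr}(A^{*\top}A^* )-\min\operatorname{Tr}(H^\top A^*H),$$ where $H=(h_1,\dots,h_K)$ with $h_k^\top h_l=\delta_{kl}$, $H^\top H=I$, and $A^{*\top}A^*=\text{const}$. Expanding the optimal Kernel K-means loss, $$\min\mathcal{L}_{A^*}=\text{const}-\min\operatorname{Tr}(H^\top A^*H)=\min\bigl(\|A^*\|^2-2\operatorname{Tr}(H^\top A^*H)+\|H^\top H\|^2\bigr).$$ This is equivalent to an instance of optimal symmetric non-negative matrix factorization (SNMF): $$\min_{H^\top H=I,\;H\ge 0}\|A^*-HH^\top\|^2.$$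
   Context: Here $f^*(X)=[f^*(x_1),\dots,f^*(x_n)]$, so $A^*_{ij}=f^*(x_i)^\top f^*(x_j)$. The asterisk marks components that have been optimized to their respective optimal conditions; $\bar A^*$ is the optimal normalized co-occurrence (cosine similarity) matrix of the samples. Kernel K-means means K-means applied to the inner products of the features; $C_1,\dots,C_K$ are the clusters, $n_k$ is the size of $C_k$, and $\mathcal{L}_{A^*}$ is the Kernel K-means loss for the features $f^*(x_i)$. The matrix $H$ encodes the clustering solution by $K$ indicator vectors: $h_k$ has entries $1/\sqrt{n_k}$ at the $n_k$ samples of cluster $C_k$ and $0$ elsewhere. $\delta_{kl}$ is the Kronecker delta, $H\ge 0$ means entrywise non-negativity, and $\|\cdot\|$ of a matrix is the Frobenius norm. SNMF of a symmetric matrix $V$ is the problem $\min_{H\ge 0}\|V-HH^\top\|_F^2$. "const" denotes a quantity regarded as constant for the fixed network.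
   Formalization: Exact values use Tr(A* ), not Tr(A*ᵀA* ); const − min Tr(HᵀA*H) becomes const − max; the last expression matches the loss only up to a positive affine change; K-means equals SNMF over cluster indicators H; over all HᵀH=I, H≥0 only the trace form does, with a criterion for agreement. *)

theory Defs
  imports "HOL-Analysis.Analysis"
begin

text \<open>
  Samples are indexed by a finite type \<open>'n\<close> and clusters by a finite type \<open>'k\<close>, so that
  \<open>n = CARD('n)\<close>, \<open>K = CARD('k)\<close>, and an \<open>n \<times> K\<close> matrix has type \<^typ>\<open>real ^ 'k ^ 'n\<close>.
  On matrices, \<^const>\<open>norm\<close> is the Frobenius norm.
\<close>

definition kernel_matrix :: "('x \<Rightarrow> 'h::real_inner) \<Rightarrow> ('n::finite \<Rightarrow> 'x) \<Rightarrow> real ^ 'n ^ 'n" where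
  "kernel_matrix f x = (\<chi> i j. f (x i) \<bullet> f (x j))"

definition cosine_matrix :: "('x \<Rightarrow> 'h::real_inner) \<Rightarrow> ('n::finite \<Rightarrow> 'x) \<Rightarrow> real ^ 'n ^ 'n" where
  "cosine_matrix f x = (\<chi> i j. (f (x i) \<bullet> f (x j)) / (norm (f (x i)) * norm (f (x j))))"

text \<open>Clusters are required to be non-empty, as the entries \<open>1 / sqrt n\<^sub>k\<close> below presuppose.\<close>

definition clusterings :: "('k::finite \<Rightarrow> 'n::finite set) set" where
  "clusterings = {C. disjoint_family C \<and> (\<Union>k. C k) = UNIV \<and> (\<forall>k. C k \<noteq> {})}"

definition centroid :: "('x \<Rightarrow> 'h::real_inner) \<Rightarrow> ('n::finite \<Rightarrow> 'x) \<Rightarrow> 'n set \<Rightarrow> 'h" where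
  "centroid f x S = (1 / real (card S)) *\<^sub>R (\<Sum>i\<in>S. f (x i))"

definition kmeans_loss ::
  "('x \<Rightarrow> 'h::real_inner) \<Rightarrow> ('n::finite \<Rightarrow> 'x) \<Rightarrow> ('k::finite \<Rightarrow> 'n set) \<Rightarrow> real" where
  "kmeans_loss f x C = (\<Sum>k\<in>UNIV. \<Sum>i\<in>C k. (norm (f (x i) - centroid f x (C k)))\<^sup>2)"

text \<open>Column \<open>k\<close> of the following matrix is the indicator vector \<open>h\<^sub>k\<close>.\<close>

definition indicator_matrix :: "('k::finite \<Rightarrow> 'n::finite set) \<Rightarrow> real ^ 'k ^ 'n" where
  "indicator_matrix C = (\<chi> i k. if i \<in> C k then 1 / sqrt (real (card (C k))) else 0)"

definition nonneg_matrix :: "real ^ 'k::finite ^ 'n::finite \<Rightarrow> bool" where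
  "nonneg_matrix H \<longleftrightarrow> (\<forall>i k. 0 \<le> H $ i $ k)"

definition snmf_loss :: "real ^ 'n ^ 'n \<Rightarrow> real ^ 'k::finite ^ 'n::finite \<Rightarrow> real" where
  "snmf_loss V H = (norm (V - H ** transpose H))\<^sup>2"

text \<open>
  This set is in general strictly larger than the set of cluster indicator matrices: the positive
  entries of a column need not be equal, and rows may vanish.
\<close>

definition snmf_feasible :: "(real ^ 'k::finite ^ 'n::finite) set" where
  "snmf_feasible = {H. transpose H ** H = mat 1 \<and> nonneg_matrix H}"

abbreviation is_minimizer_on :: "('a \<Rightarrow> real) \<Rightarrow> 'a set \<Rightarrow> 'a \<Rightarrow> bool" where
  "is_minimizer_on J S \<equiv> is_arg_min J (\<lambda>z. z \<in> S)"

end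

theory Submission
  imports Defs
begin

text \<open>
  Both losses are affine functions of \<open>trace (H\<^sup>T A H)\<close>: K-means because the scatter of a cluster
  \<open>S\<close> about its centroid is \<open>\<Sum>\<^sub>i \<parallel>v\<^sub>i\<parallel>\<^sup>2 - (1/|S|) \<Sum>\<^sub>i\<^sub>j v\<^sub>i \<bullet> v\<^sub>j\<close>, and SNMF because
  \<open>\<parallel>H\<^sup>T H\<parallel>\<^sup>2\<close> is constant under the constraint \<open>H\<^sup>T H = I\<close>. Minimizers and minimal values
  therefore correspond. Minima exist since there are finitely many clusterings, and since the
  feasible set of SNMF is compact.
\<close>

section \<open>Minimizers under changes of objective and domain\<close>

lemma INF_eq_minimizer:
  assumes "is_minimizer_on J S m"
  shows "(INF z\<in>S. J z) = J m"
proof (rule cInf_eq_minimum)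
  show "J m \<in> J ` S"
    using assms by (auto simp: is_arg_min_def)
  show "J m \<le> y" if "y \<in> J ` S" for y
    using assms that by (force simp: is_arg_min_def not_less)
qed

text \<open>Increasing affine maps preserve strict comparison of values. With \<open>b = 2\<close>
  this passes between SNMF and the trace objective; with \<open>b = 1\<close> it replaces an
  additive constant.\<close>

lemma minimizer_affine_iff:
  assumes "\<And>z. z \<in> S \<Longrightarrow> J z = a + b * G z" and "b > 0"
  shows "is_minimizer_on J S m \<longleftrightarrow> is_minimizer_on G S m"
  using assms by (auto simp: is_arg_min_def)

lemma minimizer_image_iff:
  assumes "\<And>z. z \<in> S \<Longrightarrow> J z = G (h z)" and "m \<in> S"
  shows "is_minimizer_on J S m \<longleftrightarrow> is_minimizer_on G (h ` S) (h m)"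
  using assms by (auto simp: is_arg_min_def)

lemma minimizer_subset:
  assumes "is_minimizer_on J S m" and "T \<subseteq> S" and "m \<in> T"
  shows "is_minimizer_on J T m"
  using assms by (auto simp: is_arg_min_def)

section \<open>Trace identities and the expansion of the SNMF loss\<close>

lemma transpose_mult_self_nth:
  fixes H :: "real ^ 'k::finite ^ 'n::finite"
  shows "(transpose H ** H) $ k $ l = column k H \<bullet> column l H"
  by (simp add: matrix_matrix_mult_def transpose_def column_def inner_vec_def)

lemma trace_quadratic_form:
  fixes A :: "real ^ 'n::finite ^ 'n" and H :: "real ^ 'k::finite ^ 'n"
  shows "trace (transpose H ** A ** H) = (\<Sum>k\<in>UNIV. \<Sum>i\<in>UNIV. \<Sum>j\<in>UNIV. H $ i $ k * A $ i $ j * H $ j $ k)"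
proof -
  have "trace (transpose H ** A ** H) = (\<Sum>k\<in>UNIV. \<Sum>j\<in>UNIV. \<Sum>i\<in>UNIV. H $ i $ k * A $ i $ j * H $ j $ k)"
    by (simp add: trace_def matrix_matrix_mult_def transpose_def sum_distrib_right)
  also have "\<dots> = (\<Sum>k\<in>UNIV. \<Sum>i\<in>UNIV. \<Sum>j\<in>UNIV. H $ i $ k * A $ i $ j * H $ j $ k)"
    by (intro sum.cong refl sum.swap)
  finally show ?thesis .
qed

lemma norm_matrix_squared:
  fixes M :: "real ^ 'm::finite ^ 'n::finite"
  shows "(norm M)\<^sup>2 = (\<Sum>i\<in>UNIV. \<Sum>j\<in>UNIV. (M $ i $ j)\<^sup>2)"
  unfolding power2_norm_eq_inner by (simp add: inner_vec_def power2_eq_square)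

text \<open>The inner product of matrices is the Frobenius one, so both sides are one triple sum in
  different orders. This is the cross term of the SNMF loss.\<close>

lemma inner_gram_eq_trace:
  fixes A :: "real ^ 'n::finite ^ 'n" and H :: "real ^ 'k::finite ^ 'n"
  shows "A \<bullet> (H ** transpose H) = trace (transpose H ** A ** H)"
proof -
  have "A \<bullet> (H ** transpose H) = (\<Sum>i\<in>UNIV. \<Sum>j\<in>UNIV. \<Sum>k\<in>UNIV. H $ i $ k * A $ i $ j * H $ j $ k)"
    by (simp add: inner_vec_def matrix_matrix_mult_def transpose_def sum_distrib_left mult_ac)
  also have "\<dots> = (\<Sum>i\<in>UNIV. \<Sum>k\<in>UNIV. \<Sum>j\<in>UNIV. H $ i $ k * A $ i $ j * H $ j $ k)"
    by (intro sum.cong refl sum.swap)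
  also have "\<dots> = (\<Sum>k\<in>UNIV. \<Sum>i\<in>UNIV. \<Sum>j\<in>UNIV. H $ i $ k * A $ i $ j * H $ j $ k)"
    by (rule sum.swap)
  finally show ?thesis
    by (simp add: trace_quadratic_form)
qed

text \<open>Both sides are the trace of \<open>transpose H ** H ** transpose H ** H\<close>. The
  exchange brings in the K by K Gram matrix, which the constraint fixes to the identity.\<close>

lemma norm_gram_swap:
  fixes H :: "real ^ 'k::finite ^ 'n::finite"
  shows "(norm (H ** transpose H))\<^sup>2 = (norm (transpose H ** H))\<^sup>2"
proof -
  have "(norm (H ** transpose H))\<^sup>2 = trace (transpose H ** (H ** transpose H) ** H)"
    by (simp add: power2_norm_eq_inner inner_gram_eq_trace)
  also have "\<dots> = trace ((transpose H ** H) ** (transpose H ** H))"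
    by (simp add: matrix_mul_assoc)
  also have "\<dots> = (\<Sum>k\<in>UNIV. \<Sum>l\<in>UNIV. ((transpose H ** H) $ k $ l)\<^sup>2)"
  proof -
    \<comment> \<open>Only the outer product is unfolded; the entries remain inner products of
      columns, whose symmetry turns each summand into a square.\<close>
    have "trace ((transpose H ** H) ** (transpose H ** H))
        = (\<Sum>k\<in>UNIV. \<Sum>l\<in>UNIV. (transpose H ** H) $ k $ l * (transpose H ** H) $ l $ k)"
      unfolding trace_def matrix_matrix_mult_def[of "transpose H ** H"] by simp
    then show ?thesis
      by (simp add: transpose_mult_self_nth power2_eq_square inner_commute)
  qed
  finally show ?thesis
    by (simp add: norm_matrix_squared)
qed

lemma snmf_loss_expand:
  fixes A :: "real ^ 'n::finite ^ 'n" and H :: "real ^ 'k::finite ^ 'n"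
  shows "snmf_loss A H =
    (norm A)\<^sup>2 - 2 * trace (transpose H ** A ** H) + (norm (transpose H ** H))\<^sup>2"
  unfolding snmf_loss_def norm_gram_swap[symmetric] inner_gram_eq_trace[symmetric]
  by (simp add: power2_norm_eq_inner inner_diff_left inner_diff_right inner_commute)

lemma norm_mat_1_squared: "(norm (mat 1 :: real ^ 'k::finite ^ 'k))\<^sup>2 = real CARD('k)"
  by (simp add: norm_matrix_squared mat_def if_distrib[of "\<lambda>t. t ^ 2"] cong: if_cong)

text \<open>The constraint makes the last term of the expansion K. Adding and subtracting
  \<open>2 * trace A\<close> shapes the bracket like the K-means loss in
  \<open>kmeans_loss_trace\<close>.\<close>

lemma snmf_loss_feasible:
  fixes A :: "real ^ 'n::finite ^ 'n" and H :: "real ^ 'k::finite ^ 'n"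
  assumes "H \<in> snmf_feasible"
  shows "snmf_loss A H =
    (norm A)\<^sup>2 + real CARD('k) - 2 * trace A + 2 * (trace A - trace (transpose H ** A ** H))"
  using assms by (simp add: snmf_loss_expand snmf_feasible_def norm_mat_1_squared)

section \<open>Existence of SNMF minimizers\<close>

lemma compact_snmf_feasible: "compact (snmf_feasible :: (real ^ 'k::finite ^ 'n::finite) set)"
proof -
  \<comment> \<open>Entrywise, the constraints are equations and weak inequalities between
    continuous functions, hence closed conditions.\<close>
  have eq: "(snmf_feasible :: (real ^ 'k ^ 'n) set) =
     {H. (\<forall>k l. (\<Sum>i\<in>UNIV. H $ i $ k * H $ i $ l) = (if k = l then 1 else 0))
        \<and> (\<forall>i k. 0 \<le> H $ i $ k)}"
    by (simp add: snmf_feasible_def nonneg_matrix_def vec_eq_iff mat_def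
        matrix_matrix_mult_def transpose_def)
  have "closed (snmf_feasible :: (real ^ 'k ^ 'n) set)"
    unfolding eq
    by (intro closed_Collect_conj closed_Collect_all closed_Collect_eq closed_Collect_le
        continuous_intros)
  \<comment> \<open>Boundedness: each of the K columns is a unit vector.\<close>
  moreover have "(norm H)\<^sup>2 = real CARD('k)" if "H \<in> snmf_feasible" for H :: "real ^ 'k ^ 'n"
  proof -
    have "(norm H)\<^sup>2 = (\<Sum>k\<in>UNIV. \<Sum>i\<in>UNIV. H $ i $ k * H $ i $ k)"
      unfolding norm_matrix_squared by (subst sum.swap) (simp add: power2_eq_square)
    also have "\<dots> = real CARD('k)"
      using that unfolding eq by simp
    finally show ?thesis .
  qed
  then have "norm H \<le> sqrt (real CARD('k))" if "H \<in> snmf_feasible" for H :: "real ^ 'k ^ 'n"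
    using that by (metis real_le_rsqrt order_refl)
  then have "bounded (snmf_feasible :: (real ^ 'k ^ 'n) set)"
    by (auto simp: bounded_iff)
  ultimately show ?thesis
    by (simp add: compact_eq_bounded_closed)
qed

lemma continuous_on_snmf_loss:
  "continuous_on S (snmf_loss A :: real ^ 'k::finite ^ 'n::finite \<Rightarrow> real)"
  unfolding snmf_loss_def[abs_def] matrix_matrix_mult_def transpose_def
  by (intro continuous_intros)

lemma snmf_loss_minimizer_exists:
  assumes "(snmf_feasible :: (real ^ 'k::finite ^ 'n::finite) set) \<noteq> {}"
  shows "\<exists>H :: real ^ 'k ^ 'n. is_minimizer_on (snmf_loss A) snmf_feasible H"
  using continuous_attains_inf[OF compact_snmf_feasible assms continuous_on_snmf_loss]
  by (fastforce simp: is_arg_min_def not_less)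

section \<open>Clusterings and their indicator matrices\<close>

lemma clusterings_nonempty:
  assumes "CARD('k::finite) \<le> CARD('n::finite)"
  shows "(clusterings :: ('k \<Rightarrow> 'n set) set) \<noteq> {}"
proof -
  obtain g :: "'k \<Rightarrow> 'n" where g: "inj g"
    using assms card_le_inj[of "UNIV :: 'k set" "UNIV :: 'n set"] by auto
  \<comment> \<open>The fibers of a left inverse of \<open>g\<close> partition the samples, and the
    fiber over \<open>k\<close> contains \<open>g k\<close>.\<close>
  have "(\<lambda>k. {i. inv g i = k}) \<in> clusterings"
    using inv_f_f[OF g] by (auto simp: clusterings_def disjoint_family_on_def)
  then show ?thesis
    by blast
qed

text \<open>A member of \<open>C k\<close> makes its cardinality positive, so
  \<open>1 / sqrt\<close> of it is nonzero. The zero pattern therefore recovers the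
  clusters.\<close>

lemma indicator_matrix_nth_eq_0_iff:
  "indicator_matrix C $ i $ k = 0 \<longleftrightarrow> i \<notin> C k"
  by (auto simp: indicator_matrix_def)

lemma inj_indicator_matrix: "inj indicator_matrix"
proof (rule injI)
  fix C D :: "'k::finite \<Rightarrow> 'n::finite set"
  assume "indicator_matrix C = indicator_matrix D"
  then have "i \<in> C k \<longleftrightarrow> i \<in> D k" for i k
    using indicator_matrix_nth_eq_0_iff by metis
  then show "C = D"
    by blast
qed

lemma indicator_matrix_orthonormal:
  assumes C: "C \<in> clusterings"
  shows "column k (indicator_matrix C) \<bullet> column l (indicator_matrix C) = (if k = l then 1 else 0)"
proof (cases "k = l")
  case True
  have ne: "C k \<noteq> {}"
    using C by (auto simp: clusterings_def)
  have "column k (indicator_matrix C) \<bullet> column k (indicator_matrix C) =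
      (\<Sum>i\<in>UNIV. if i \<in> C k then 1 / real (card (C k)) else 0)"
    by (auto simp: column_def inner_vec_def indicator_matrix_def intro!: sum.cong)
  also have "\<dots> = (\<Sum>i\<in>C k. 1 / real (card (C k)))"
    by (simp add: sum.If_cases)
  also have "\<dots> = 1"
    using ne by simp
  finally show ?thesis
    using True by simp
next
  case False
  then have "C k \<inter> C l = {}"
    using C by (auto simp: clusterings_def disjoint_family_on_def)
  then show ?thesis
    using False by (auto simp: column_def inner_vec_def indicator_matrix_def intro!: sum.neutral)
qed

lemma indicator_matrix_feasible:
  assumes "C \<in> clusterings"
  shows "indicator_matrix C \<in> snmf_feasible"
  using indicator_matrix_orthonormal[OF assms]
  by (simp add: snmf_feasible_def nonneg_matrix_def vec_eq_iff transpose_mult_self_nth mat_def)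
    (simp add: indicator_matrix_def)

section \<open>The K-means loss and the kernel matrix\<close>

lemma scatter_about_centroid:
  assumes "S \<noteq> {}"
  shows "(\<Sum>i\<in>S. (norm (f (x i) - centroid f x S))\<^sup>2) =
    (\<Sum>i\<in>S. (norm (f (x i)))\<^sup>2) - (\<Sum>i\<in>S. \<Sum>j\<in>S. f (x i) \<bullet> f (x j)) / real (card S)"
proof -
  define s where "s = (\<Sum>i\<in>S. f (x i))"
  define c where "c = centroid f x S"
  have s: "s = real (card S) *\<^sub>R c"
    using assms by (simp add: s_def c_def centroid_def)
  have "(\<Sum>i\<in>S. (norm (f (x i) - c))\<^sup>2)
      = (\<Sum>i\<in>S. (norm (f (x i)))\<^sup>2 - 2 * (f (x i) \<bullet> c) + c \<bullet> c)"
    by (simp add: power2_norm_eq_inner inner_diff_left inner_diff_right inner_commute algebra_simps)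
  also have "\<dots> = (\<Sum>i\<in>S. (norm (f (x i)))\<^sup>2) - 2 * (s \<bullet> c) + real (card S) * (c \<bullet> c)"
    by (simp add: sum.distrib sum_subtractf s_def inner_sum_left sum_distrib_left)
  \<comment> \<open>With m the size of \<open>S\<close> and \<open>s\<close> equal to m times
    \<open>c\<close>, the last two terms sum to -m \<open>(c \<bullet> c)\<close>, which is minus
    \<open>s \<bullet> s\<close> over m.\<close>
  also have "\<dots> = (\<Sum>i\<in>S. (norm (f (x i)))\<^sup>2) - (s \<bullet> s) / real (card S)"
    using assms by (simp add: s)
  also have "s \<bullet> s = (\<Sum>i\<in>S. \<Sum>j\<in>S. f (x i) \<bullet> f (x j))"
    unfolding s_def inner_sum_left inner_sum_right by (rule sum.swap)
  finally show ?thesis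
    by (simp add: c_def)
qed

lemma kmeans_loss_indicator:
  assumes C: "C \<in> clusterings"
  shows "kmeans_loss f x C = (\<Sum>i\<in>UNIV. (norm (f (x i)))\<^sup>2)
    - (\<Sum>k\<in>UNIV. \<Sum>i\<in>C k. \<Sum>j\<in>C k.
         indicator_matrix C $ i $ k * (f (x i) \<bullet> f (x j)) * indicator_matrix C $ j $ k)"
proof -
  have ne: "C k \<noteq> {}" for k
    using C by (auto simp: clusterings_def)
  have "(\<Sum>i\<in>UNIV. (norm (f (x i)))\<^sup>2) = (\<Sum>i\<in>(\<Union>k. C k). (norm (f (x i)))\<^sup>2)"
    using C by (simp add: clusterings_def)
  also have "\<dots> = (\<Sum>k\<in>UNIV. \<Sum>i\<in>C k. (norm (f (x i)))\<^sup>2)"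
    using C by (intro sum.UNION_disjoint) (auto simp: clusterings_def disjoint_family_on_def)
  finally have split: "(\<Sum>i\<in>UNIV. (norm (f (x i)))\<^sup>2) = (\<Sum>k\<in>UNIV. \<Sum>i\<in>C k. (norm (f (x i)))\<^sup>2)" .
  \<comment> \<open>The two factors \<open>1 / sqrt\<close> of the cluster size multiply to the
    weight in the scatter formula.\<close>
  have block: "(\<Sum>i\<in>C k. \<Sum>j\<in>C k.
      indicator_matrix C $ i $ k * (f (x i) \<bullet> f (x j)) * indicator_matrix C $ j $ k)
    = (\<Sum>i\<in>C k. \<Sum>j\<in>C k. f (x i) \<bullet> f (x j)) / real (card (C k))" for k
    by (simp add: indicator_matrix_def sum_divide_distrib)
  show ?thesis
    unfolding kmeans_loss_def split block scatter_about_centroid[OF ne] sum_subtractf ..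
qed

lemma kmeans_loss_trace:
  assumes C: "C \<in> clusterings"
  shows "kmeans_loss f x C = trace (kernel_matrix f x)
    - trace (transpose (indicator_matrix C) ** kernel_matrix f x ** indicator_matrix C)"
proof -
  let ?H = "indicator_matrix C"
  \<comment> \<open>Column \<open>k\<close> vanishes off \<open>C k\<close>, so first
    \<open>j\<close> and then \<open>i\<close> can be restricted to the cluster.\<close>
  have "(\<Sum>i\<in>UNIV. \<Sum>j\<in>UNIV. ?H $ i $ k * kernel_matrix f x $ i $ j * ?H $ j $ k)
      = (\<Sum>i\<in>C k. \<Sum>j\<in>C k. ?H $ i $ k * (f (x i) \<bullet> f (x j)) * ?H $ j $ k)" for k
  proof -
    have "(\<Sum>j\<in>UNIV. ?H $ i $ k * kernel_matrix f x $ i $ j * ?H $ j $ k)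
        = (\<Sum>j\<in>C k. ?H $ i $ k * (f (x i) \<bullet> f (x j)) * ?H $ j $ k)" for i
      by (rule sum.mono_neutral_cong_right)
        (auto simp: kernel_matrix_def indicator_matrix_nth_eq_0_iff)
    moreover have "(\<Sum>i\<in>UNIV. \<Sum>j\<in>C k. ?H $ i $ k * (f (x i) \<bullet> f (x j)) * ?H $ j $ k)
        = (\<Sum>i\<in>C k. \<Sum>j\<in>C k. ?H $ i $ k * (f (x i) \<bullet> f (x j)) * ?H $ j $ k)"
      by (rule sum.mono_neutral_right) (auto simp: indicator_matrix_def)
    ultimately show ?thesis
      by simp
  qed
  moreover have "trace (kernel_matrix f x) = (\<Sum>i\<in>UNIV. (norm (f (x i)))\<^sup>2)"
    by (simp add: trace_def kernel_matrix_def power2_norm_eq_inner)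
  ultimately show ?thesis
    by (simp add: kmeans_loss_indicator[OF C] trace_quadratic_form)
qed

text \<open>If a feature vector vanishes, both sides are 0; otherwise the norms cancel.\<close>

lemma kernel_matrix_nth_cosine:
  "kernel_matrix f x $ i $ j = norm (f (x i)) * norm (f (x j)) * cosine_matrix f x $ i $ j"
  by (auto simp: kernel_matrix_def cosine_matrix_def)

section \<open>Comparison of the two minimization problems\<close>

theorem theorem1:
  fixes x :: "'n::finite \<Rightarrow> 'x"
    and fstar :: "'x \<Rightarrow> 'h::{real_inner, complete_space}"
    and A :: "real ^ 'n ^ 'n"
    and clus :: "('k::finite \<Rightarrow> 'n set) set"
    and feas :: "(real ^ 'k ^ 'n) set"
  assumes A: "A = kernel_matrix fstar x"
    and clus: "clus = clusterings"
    and feas: "feas = snmf_feasible"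
    and K_le_n: "CARD('k) \<le> CARD('n)"
  shows
    \<comment> \<open>\<open>A\<close> is the unnormalized cosine similarity matrix\<close>
    "(\<forall>i j. A $ i $ j = norm (fstar (x i)) * norm (fstar (x j)) * cosine_matrix fstar x $ i $ j)
   \<and> \<comment> \<open>clusterings are encoded by feasible matrices, and the objectives are rewritten pointwise\<close>
     inj_on indicator_matrix clus \<and> indicator_matrix ` clus \<subseteq> feas
   \<and> (\<forall>C\<in>clus. \<forall>k l. column k (indicator_matrix C) \<bullet> column l (indicator_matrix C)
                       = (if k = l then 1 else 0))
   \<and> (\<forall>C\<in>clus. kmeans_loss fstar x C =
        (\<Sum>i\<in>UNIV. (norm (fstar (x i)))\<^sup>2)
        - (\<Sum>k\<in>UNIV. \<Sum>i\<in>C k. \<Sum>j\<in>C k.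
             indicator_matrix C $ i $ k * (fstar (x i) \<bullet> fstar (x j)) * indicator_matrix C $ j $ k))
   \<and> (\<forall>C\<in>clus. kmeans_loss fstar x C =
        trace A - trace (transpose (indicator_matrix C) ** A ** indicator_matrix C))
   \<and> (\<forall>H :: real ^ 'k ^ 'n. snmf_loss A H =
        (norm A)\<^sup>2 - 2 * trace (transpose H ** A ** H) + (norm (transpose H ** H))\<^sup>2)
   \<and> \<comment> \<open>all minima are attained\<close>
     (\<exists>C. is_minimizer_on (kmeans_loss fstar x) clus C)
   \<and> (\<exists>H. is_minimizer_on (snmf_loss A) feas H)
   \<and> \<comment> \<open>minimization over cluster indicator matrices: minimal values and minimizers\<close>
     (INF C\<in>clus. kmeans_loss fstar x C) =
        trace A - (SUP H\<in>indicator_matrix ` clus. trace (transpose H ** A ** H))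
   \<and> (INF H\<in>indicator_matrix ` clus. snmf_loss A H) =
        (norm A)\<^sup>2 + real CARD('k) - 2 * trace A + 2 * (INF C\<in>clus. kmeans_loss fstar x C)
   \<and> (\<forall>C\<in>clus.
        (is_minimizer_on (kmeans_loss fstar x) clus C \<longleftrightarrow>
           is_minimizer_on (\<lambda>H. trace (transpose A ** A) - trace (transpose H ** A ** H))
             (indicator_matrix ` clus) (indicator_matrix C))
      \<and> (is_minimizer_on (kmeans_loss fstar x) clus C \<longleftrightarrow>
           is_minimizer_on (snmf_loss A) (indicator_matrix ` clus) (indicator_matrix C)))
   \<and> \<comment> \<open>minimization of the trace form of the objective over all non-negative \<open>H\<close> with \<open>H\<^sup>T H = I\<close>\<close>
     (INF H\<in>feas. snmf_loss A H) =
        (norm A)\<^sup>2 + real CARD('k) - 2 * trace A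
        + 2 * (INF H\<in>feas. trace A - trace (transpose H ** A ** H))
   \<and> (\<forall>H. is_minimizer_on (snmf_loss A) feas H \<longleftrightarrow>
           is_minimizer_on (\<lambda>H. trace A - trace (transpose H ** A ** H)) feas H)
   \<and> \<comment> \<open>comparison of the two feasible sets\<close>
     (INF H\<in>feas. snmf_loss A H) \<le>
        (norm A)\<^sup>2 + real CARD('k) - 2 * trace A + 2 * (INF C\<in>clus. kmeans_loss fstar x C)
   \<and> ((INF H\<in>feas. snmf_loss A H) =
        (norm A)\<^sup>2 + real CARD('k) - 2 * trace A + 2 * (INF C\<in>clus. kmeans_loss fstar x C)
      \<longleftrightarrow> (\<exists>C\<in>clus. is_minimizer_on (snmf_loss A) feas (indicator_matrix C)))
   \<and> (\<forall>C\<in>clus. is_minimizer_on (snmf_loss A) feas (indicator_matrix C) \<longrightarrow>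
        is_minimizer_on (kmeans_loss fstar x) clus C)"
proof -
  let ?J = "kmeans_loss fstar x"
  let ?I = "indicator_matrix :: ('k \<Rightarrow> 'n set) \<Rightarrow> real ^ 'k ^ 'n"
  let ?q = "\<lambda>H :: real ^ 'k ^ 'n. trace (transpose H ** A ** H)"
  let ?c = "(norm A)\<^sup>2 + real CARD('k) - 2 * trace A"
  have sub: "?I ` clus \<subseteq> feas"
    using indicator_matrix_feasible by (auto simp: clus feas)
  have J: "?J C = trace A - ?q (?I C)" if "C \<in> clus" for C
    using kmeans_loss_trace that by (auto simp: A clus)
  have L: "snmf_loss A H = ?c + 2 * (trace A - ?q H)" if "H \<in> feas" for H
    using that unfolding feas by (rule snmf_loss_feasible)
  have LJ: "snmf_loss A (?I C) = ?c + 2 * ?J C" if "C \<in> clus" for C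
    using L J sub that by auto
  have clus_ne: "clus \<noteq> {}"
    using clusterings_nonempty[OF K_le_n] by (simp add: clus)
  obtain C0 where C0: "is_minimizer_on ?J clus C0"
    using ex_is_arg_min_if_finite[OF _ clus_ne, of ?J] by auto
  then have C0_in: "C0 \<in> clus"
    by (simp add: is_arg_min_def)
  obtain H0 where H0: "is_minimizer_on (snmf_loss A) feas H0"
    using snmf_loss_minimizer_exists sub clus_ne unfolding feas by blast
  \<comment> \<open>The constant \<open>t\<close> is left free: the loss itself has
    \<open>trace A\<close>, whereas one claim about minimizers has
    \<open>trace (transpose A ** A)\<close>.\<close>
  have kmeans_trace_iff: "is_minimizer_on ?J clus C \<longleftrightarrow>
      is_minimizer_on (\<lambda>H. t - ?q H) (?I ` clus) (?I C)" if "C \<in> clus" for C t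
  proof -
    have "is_minimizer_on ?J clus C \<longleftrightarrow> is_minimizer_on (\<lambda>H. trace A - ?q H) (?I ` clus) (?I C)"
      using J that by (intro minimizer_image_iff) auto
    also have "\<dots> \<longleftrightarrow> is_minimizer_on (\<lambda>H. t - ?q H) (?I ` clus) (?I C)"
      by (rule minimizer_affine_iff[where a = "trace A - t" and b = 1]) auto
    finally show ?thesis .
  qed
  have kmeans_snmf_iff: "is_minimizer_on ?J clus C \<longleftrightarrow>
      is_minimizer_on (snmf_loss A) (?I ` clus) (?I C)" if "C \<in> clus" for C
  proof -
    have "is_minimizer_on (snmf_loss A) (?I ` clus) (?I C) \<longleftrightarrow>
        is_minimizer_on (\<lambda>H. trace A - ?q H) (?I ` clus) (?I C)"
      using L sub by (intro minimizer_affine_iff[where a = ?c and b = 2]) auto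
    then show ?thesis
      using kmeans_trace_iff[OF that] by simp
  qed
  have snmf_trace_iff: "is_minimizer_on (snmf_loss A) feas H \<longleftrightarrow>
      is_minimizer_on (\<lambda>H. trace A - ?q H) feas H" for H
    using L by (intro minimizer_affine_iff[where a = ?c and b = 2]) auto
  have INF_J: "(INF C\<in>clus. ?J C) = ?J C0"
    by (rule INF_eq_minimizer[OF C0])
  \<comment> \<open>Minimizing \<open>trace A - ?q H\<close> maximizes \<open>?q\<close>, hence a
    supremum, attained at the matrix of \<open>C0\<close>.\<close>
  have SUP_q: "(SUP H\<in>?I ` clus. ?q H) = ?q (?I C0)"
  proof (rule cSup_eq_maximum)
    show "?q (?I C0) \<in> ?q ` ?I ` clus"
      using C0_in by blast
    show "y \<le> ?q (?I C0)" if "y \<in> ?q ` ?I ` clus" for y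
    proof -
      obtain C where "C \<in> clus" and y: "y = ?q (?I C)"
        using \<open>y \<in> ?q ` ?I ` clus\<close> by blast
      then have "?J C0 \<le> ?J C"
        using C0 by (auto simp: is_arg_min_def not_less)
      then show ?thesis
        using J[OF C0_in] J[OF \<open>C \<in> clus\<close>] y by simp
    qed
  qed
  have INF_I: "(INF H\<in>?I ` clus. snmf_loss A H) = snmf_loss A (?I C0)"
    using C0 kmeans_snmf_iff[OF C0_in] by (intro INF_eq_minimizer) simp
  have INF_L: "(INF H\<in>feas. snmf_loss A H) = snmf_loss A H0"
    by (rule INF_eq_minimizer[OF H0])
  have INF_q: "(INF H\<in>feas. trace A - ?q H) = trace A - ?q H0"
    using H0 snmf_trace_iff by (intro INF_eq_minimizer) simp
  have H0_in: "H0 \<in> feas"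
    using H0 by (simp add: is_arg_min_def)
  have H0_le: "snmf_loss A H0 \<le> snmf_loss A H" if "H \<in> feas" for H
    using H0 that by (auto simp: is_arg_min_def not_less)
  \<comment> \<open>A minimizer over \<open>feas\<close> that lies in the smaller set of indicator
    matrices is a minimizer there too.\<close>
  have restrict: "is_minimizer_on ?J clus C"
    if "C \<in> clus" "is_minimizer_on (snmf_loss A) feas (?I C)" for C
    using kmeans_snmf_iff that minimizer_subset[OF that(2) sub] by blast
  \<comment> \<open>SNMF relaxes K-means, and the two optima match exactly when some clustering
    attains the relaxed one. Forwards the witness is \<open>C0\<close>; backwards, all minimizers of
    one problem share its value.\<close>
  have tight: "snmf_loss A H0 = ?c + 2 * ?J C0 \<longleftrightarrow>
      (\<exists>C\<in>clus. is_minimizer_on (snmf_loss A) feas (?I C))"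
  proof
    assume "snmf_loss A H0 = ?c + 2 * ?J C0"
    then have "snmf_loss A (?I C0) = snmf_loss A H0"
      using LJ[OF C0_in] by simp
    then have "is_minimizer_on (snmf_loss A) feas (?I C0)"
      using H0 sub C0_in by (auto simp: is_arg_min_def)
    then show "\<exists>C\<in>clus. is_minimizer_on (snmf_loss A) feas (?I C)"
      using C0_in by blast
  next
    assume "\<exists>C\<in>clus. is_minimizer_on (snmf_loss A) feas (?I C)"
    then obtain C where C: "C \<in> clus" "is_minimizer_on (snmf_loss A) feas (?I C)"
      by blast
    have "?J C = ?J C0"
      using INF_eq_minimizer[OF restrict[OF C]] INF_J by simp
    moreover have "snmf_loss A (?I C) = snmf_loss A H0"
      using INF_eq_minimizer[OF C(2)] INF_L by simp
    ultimately show "snmf_loss A H0 = ?c + 2 * ?J C0"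
      using LJ[OF C(1)] by simp
  qed
  show ?thesis
    \<comment> \<open>All infima and the supremum become values at \<open>C0\<close> or
      \<open>H0\<close>.\<close>
    unfolding INF_J SUP_q INF_I INF_L INF_q
  proof (intro conjI allI ballI impI)
    show "A $ i $ j = norm (fstar (x i)) * norm (fstar (x j)) * cosine_matrix fstar x $ i $ j" for i j
      unfolding A by (rule kernel_matrix_nth_cosine)
    show "inj_on indicator_matrix clus"
      using inj_indicator_matrix by (rule inj_on_subset) simp
    show "?J C = (\<Sum>i\<in>UNIV. (norm (fstar (x i)))\<^sup>2)
        - (\<Sum>k\<in>UNIV. \<Sum>i\<in>C k. \<Sum>j\<in>C k.
             indicator_matrix C $ i $ k * (fstar (x i) \<bullet> fstar (x j)) * indicator_matrix C $ j $ k)"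
      if "C \<in> clus" for C
      using that unfolding clus by (rule kmeans_loss_indicator)
    show "column k (?I C) \<bullet> column l (?I C) = (if k = l then 1 else 0)" if "C \<in> clus" for C k l
      using that unfolding clus by (rule indicator_matrix_orthonormal)
    show "?I ` clus \<subseteq> feas"
      by (rule sub)
    show "snmf_loss A H0 \<le> ?c + 2 * ?J C0"
      using H0_le[of "?I C0"] LJ[OF C0_in] sub C0_in by auto
  qed (use C0 H0 J[OF C0_in] LJ[OF C0_in] L[OF H0_in] J snmf_loss_expand tight restrict
      kmeans_trace_iff kmeans_snmf_iff snmf_trace_iff in \<open>assumption | blast\<close>)+
qed

end
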